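(* $\mathrm{ex}_<(n,P_5^{1432})=\Theta(n\log n)$.
   Context: Edge-ordered graph: finite simple graph with a linear order on its edges; isomorphisms preserve order; subgraphs carry induced order; $\mathrm{ex}_<(n,H)$ is the maximum number of edges of an edge-ordered graph on $n$ vertices with no subgraph isomorphic to $H$. Notation: $P_k^{a_1\dots a_{k-1}}$ is the path $v_1\dots v_k$ where edge $v_iv_{i+1}$ has label $a_i$ and edges are ordered by label. *)

theory Defs
  imports Complex_Main "HOL-Library.Landau_Symbols"
begin

record 'a eograph =
  verts :: "'a set"
  edges :: "'a set set"
  eord :: "'a set rel"

definition edge_ordered_graph :: "'a eograph \<Rightarrow> bool" where
  "edge_ordered_graph G \<longleftrightarrow>
     finite (verts G) \<and>
     edges G \<subseteq> {e. e \<subseteq> verts G \<and> card e = 2} \<and>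
     linear_order_on (edges G) (eord G)"

definition eo_subgraph :: "'a eograph \<Rightarrow> 'a eograph \<Rightarrow> bool" where
  "eo_subgraph H G \<longleftrightarrow>
     edge_ordered_graph H \<and>
     verts H \<subseteq> verts G \<and> edges H \<subseteq> edges G \<and>
     eord H = eord G \<inter> edges H \<times> edges H"

definition eo_isomorphic :: "'a eograph \<Rightarrow> 'b eograph \<Rightarrow> bool" where
  "eo_isomorphic G H \<longleftrightarrow>
     (\<exists>f. bij_betw f (verts G) (verts H) \<and>
          edges H = (\<lambda>e. f ` e) ` edges G \<and>
          (\<forall>e\<in>edges G. \<forall>e'\<in>edges G. (e, e') \<in> eord G \<longleftrightarrow> (f ` e, f ` e') \<in> eord H))"

definition eo_contains :: "'a eograph \<Rightarrow> 'b eograph \<Rightarrow> bool" where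
  "eo_contains G H \<longleftrightarrow> (\<exists>G'. eo_subgraph G' G \<and> eo_isomorphic G' H)"

(* Host graphs have vertices in nat; every finite edge-ordered graph is isomorphic to such a one. *)
definition eo_avoiding_sizes :: "nat \<Rightarrow> 'b eograph \<Rightarrow> nat set" where
  "eo_avoiding_sizes n H =
     {card (edges G) | G :: nat eograph.
        edge_ordered_graph G \<and> card (verts G) = n \<and> \<not> eo_contains G H}"

definition ex_eo :: "nat \<Rightarrow> 'b eograph \<Rightarrow> nat" where
  "ex_eo n H = Max (eo_avoiding_sizes n H)"

(* The path on length as + 1 vertices with consecutive edge labels as, which should be distinct.
   The vertex i stands for the (i+1)-st vertex of the path. *)
definition eo_path :: "nat list \<Rightarrow> nat eograph" where
  "eo_path as =
     \<lparr> verts = {0..length as},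
       edges = {{i, Suc i} | i. i < length as},
       eord = {({i, Suc i}, {j, Suc j}) | i j.
                 i < length as \<and> j < length as \<and> as ! i \<le> as ! j} \<rparr>"

lemma path_edge_eq_iff: "{i, Suc i} = {j, Suc j} \<longleftrightarrow> i = j"
  by (auto simp: doubleton_eq_iff)

lemma edge_ordered_graph_eo_path:
  assumes "distinct as"
  shows "edge_ordered_graph (eo_path as)"
proof -
  let ?E = "edges (eo_path as)" and ?r = "eord (eo_path as)"
  have mem: "({i, Suc i}, {j, Suc j}) \<in> ?r \<longleftrightarrow>
      i < length as \<and> j < length as \<and> as ! i \<le> as ! j" for i j
    unfolding eo_path_def by (simp add: path_edge_eq_iff)
  have E: "e \<in> ?E \<longleftrightarrow> (\<exists>i<length as. e = {i, Suc i})" for e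
    by (auto simp: eo_path_def)
  have sub: "?r \<subseteq> ?E \<times> ?E"
    by (auto simp: eo_path_def)
  have "refl_on ?E ?r"
    unfolding refl_on_def
  proof
    fix e assume "e \<in> ?E"
    with E obtain i where "i < length as" "e = {i, Suc i}" by blast
    then show "(e, e) \<in> ?r" by (simp only: mem) simp
  qed
  moreover have "trans ?r"
  proof (rule transI)
    fix x y z assume xy: "(x, y) \<in> ?r" and yz: "(y, z) \<in> ?r"
    with sub have "x \<in> ?E" "y \<in> ?E" "z \<in> ?E" by auto
    then obtain i j k where "x = {i, Suc i}" "y = {j, Suc j}" "z = {k, Suc k}"
      unfolding E by metis
    with xy yz show "(x, z) \<in> ?r"
      by (simp only: mem) linarith
  qed
  moreover have "antisym ?r"
  proof (rule antisymI)
    fix x y assume xy: "(x, y) \<in> ?r" and yx: "(y, x) \<in> ?r"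
    with sub have "x \<in> ?E" "y \<in> ?E" by auto
    then obtain i j where ij: "x = {i, Suc i}" "y = {j, Suc j}"
      unfolding E by metis
    with xy yx have "i < length as \<and> j < length as \<and> as ! i = as ! j"
      by (simp only: mem) linarith
    with assms ij show "x = y" by (metis nth_eq_iff_index_eq)
  qed
  moreover have "total_on ?E ?r"
    unfolding total_on_def
  proof (intro ballI impI)
    fix x y assume "x \<in> ?E" "y \<in> ?E"
    then obtain i j where "i < length as" "j < length as" "x = {i, Suc i}" "y = {j, Suc j}"
      unfolding E by metis
    then show "(x, y) \<in> ?r \<or> (y, x) \<in> ?r"
      by (simp only: mem) auto
  qed
  ultimately have "linear_order_on ?E ?r"
    using sub by (auto simp: order_on_defs)
  then show ?thesis
    by (auto simp: edge_ordered_graph_def eo_path_def card_insert_if)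
qed

lemma finite_eo_avoiding_sizes: "finite (eo_avoiding_sizes n H)"
proof (rule finite_subset)
  show "eo_avoiding_sizes n H \<subseteq> {..2 ^ n}"
  proof
    fix m assume "m \<in> eo_avoiding_sizes n H"
    then obtain G :: "nat eograph" where G: "m = card (edges G)" "edge_ordered_graph G"
        "card (verts G) = n"
      by (auto simp: eo_avoiding_sizes_def)
    then have "edges G \<subseteq> Pow (verts G)" and fin: "finite (verts G)"
      by (auto simp: edge_ordered_graph_def)
    then have "card (edges G) \<le> card (Pow (verts G))"
      by (intro card_mono) auto
    with G fin show "m \<in> {..2 ^ n}" by (simp add: card_Pow)
  qed
qed simp

lemma eo_avoiding_sizes_nonempty:
  assumes "edges H \<noteq> {}"
  shows "0 \<in> eo_avoiding_sizes n H"
proof -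
  let ?G = "\<lparr> verts = {..<n}, edges = {}, eord = {} \<rparr> :: nat eograph"
  have "edge_ordered_graph ?G"
    by (auto simp: edge_ordered_graph_def order_on_defs refl_on_def)
  moreover have "\<not> eo_contains ?G H"
    using assms by (auto simp: eo_contains_def eo_subgraph_def eo_isomorphic_def)
  ultimately show ?thesis
    unfolding eo_avoiding_sizes_def by (intro CollectI exI[of _ ?G]) auto
qed

end

theory Submission
  imports Defs
begin

text \<open>
  Think of the edge order as time. A copy of the pattern is an increasing path x, y, z, w together
  with an edge at w that is older than the whole path.

  For the upper bound, delete the three oldest edges at every vertex, and let s(w) be the time from
  which w has three older edges. Then no remaining increasing path x, y, z, w starts at time s(w) or
  later, because one of three old edges at w avoids x and y. Split the vertices into equal halves L
  and H with s smaller on L than on H. Every edge at a vertex of H comes after s(w) for all w in L,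
  so the edges between L and H contain no increasing path with three edges starting in H. Hence each
  such edge is the first one at its end in L or the last one at its end in H. There are at most
  as many of them as vertices, and recursion into L and H gives n log n.

  For the lower bound, join numbers below n that differ by a power of two, and order the edges by
  the larger endpoint, then by the smaller one. A copy of the pattern would have y < w < x < z with
  z - w, z - y and x - y powers of two. But then z - w and x - y are both at most half of z - y,
  which contradicts w < x.
\<close>

section \<open>Containment as an order-preserving embedding of the pattern\<close>

lemma linear_order_on_restrict:
  assumes "linear_order_on A r" and "B \<subseteq> A"
  shows "linear_order_on B (r \<inter> B \<times> B)"
  using assms unfolding order_on_defs refl_on_def total_on_def trans_def antisym_def
  by (auto; blast)

text \<open>The inverse of an isomorphism from a subgraph of \<open>G\<close> onto \<open>H\<close>
  is such a map. Conversely, the image of \<open>H\<close> under such a map, with the order induced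
  from \<open>G\<close>, is a subgraph isomorphic to \<open>H\<close>.\<close>

lemma eo_contains_iff_embedding:
  assumes G: "edge_ordered_graph G" and H: "edge_ordered_graph H"
  shows "eo_contains G H \<longleftrightarrow>
    (\<exists>g. inj_on g (verts H) \<and> g ` verts H \<subseteq> verts G \<and> (\<forall>e\<in>edges H. g ` e \<in> edges G) \<and>
      (\<forall>e\<in>edges H. \<forall>e'\<in>edges H. (e, e') \<in> eord H \<longleftrightarrow> (g ` e, g ` e') \<in> eord G))"
    (is "_ \<longleftrightarrow> (\<exists>g. ?emb g)")
proof
  assume "eo_contains G H"
  then obtain G' f where sub: "eo_subgraph G' G" and f: "bij_betw f (verts G') (verts H)"
    and E: "edges H = (\<lambda>e. f ` e) ` edges G'"
    and ord: "\<forall>e\<in>edges G'. \<forall>e'\<in>edges G'. (e, e') \<in> eord G' \<longleftrightarrow> (f ` e, f ` e') \<in> eord H"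
    by (auto simp: eo_contains_def eo_isomorphic_def)
  let ?g = "inv_into (verts G') f"
  have g: "bij_betw ?g (verts H) (verts G')"
    using f by (rule bij_betw_inv_into)
  have inv: "?g ` f ` e = e" if "e \<in> edges G'" for e
    using that sub f
    by (intro inv_into_image_cancel)
      (auto simp: eo_subgraph_def edge_ordered_graph_def bij_betw_def)
  have "?emb ?g"
    using g sub ord inv by (auto simp: bij_betw_def eo_subgraph_def E)
  then show "\<exists>g. ?emb g" by blast
next
  assume "\<exists>g. ?emb g"
  then obtain g where emb: "?emb g" by blast
  let ?E = "(\<lambda>e. g ` e) ` edges H"
  let ?G' = "\<lparr> verts = g ` verts H, edges = ?E, eord = eord G \<inter> ?E \<times> ?E \<rparr>"
  let ?f = "inv_into (verts H) g"
  have EG: "?E \<subseteq> edges G" using emb by auto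
  have "linear_order_on ?E (eord G \<inter> ?E \<times> ?E)"
    using G EG by (intro linear_order_on_restrict) (auto simp: edge_ordered_graph_def)
  moreover have "\<forall>e\<in>?E. card e = 2" using G EG by (auto simp: edge_ordered_graph_def)
  moreover have "\<forall>e\<in>?E. e \<subseteq> g ` verts H" using H by (auto simp: edge_ordered_graph_def)
  ultimately have "edge_ordered_graph ?G'"
    using H unfolding edge_ordered_graph_def by simp blast
  then have "eo_subgraph ?G' G" using emb EG by (auto simp: eo_subgraph_def)
  moreover have inv: "?f ` g ` e = e" if "e \<in> edges H" for e
    using that H emb by (intro inv_into_image_cancel) (auto simp: edge_ordered_graph_def)
  have "bij_betw ?f (g ` verts H) (verts H)"
    using emb by (intro bij_betw_inv_into) (auto simp: bij_betw_def)
  then have "eo_isomorphic ?G' H"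
    using emb inv by (auto simp: eo_isomorphic_def image_image intro!: exI[of _ ?f])
  ultimately show "eo_contains G H" by (auto simp: eo_contains_def)
qed

text \<open>Both bounds use containment in this form. Comparing consecutive labels is enough, since
  the other comparisons follow by transitivity. The letters are chosen so that x, y, z, w is the
  increasing path and v the far end of the old edge.\<close>

lemma eo_contains_P5_1432:
  fixes t :: "'a set \<Rightarrow> nat"
  assumes G: "edge_ordered_graph G"
    and t: "\<And>e e'. e \<in> edges G \<Longrightarrow> e' \<in> edges G \<Longrightarrow> (e, e') \<in> eord G \<longleftrightarrow> t e \<le> t e'"
  shows "eo_contains G (eo_path [1, 4, 3, 2]) \<longleftrightarrow>
    (\<exists>v w z y x. distinct [v, w, z, y, x] \<and>
      {v, w} \<in> edges G \<and> {w, z} \<in> edges G \<and> {z, y} \<in> edges G \<and> {y, x} \<in> edges G \<and>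
      t {v, w} < t {y, x} \<and> t {y, x} < t {z, y} \<and> t {z, y} < t {w, z})"
    (is "_ \<longleftrightarrow> ?R")
proof -
  define P where "P = eo_path [1, 4, 3, 2]"
  have P: "edge_ordered_graph P" unfolding P_def by (rule edge_ordered_graph_eo_path) simp
  \<comment> \<open>Successor form keeps every edge of \<open>P\<close> literally of the shape
    \<open>{i, Suc i}\<close> required by \<open>ord\<close>.\<close>
  let ?n2 = "Suc (Suc 0)" and ?n3 = "Suc (Suc (Suc 0))" and ?n4 = "Suc (Suc (Suc (Suc 0)))"
  have verts: "verts P = {0, Suc 0, ?n2, ?n3, ?n4}" by (auto simp: eo_path_def P_def)
  have edges: "edges P = {{0, Suc 0}, {Suc 0, ?n2}, {?n2, ?n3}, {?n3, ?n4}}"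
    by (auto simp: eo_path_def P_def less_Suc_eq)
  have ord: "({i, Suc i}, {j, Suc j}) \<in> eord P \<longleftrightarrow>
      i < ?n4 \<and> j < ?n4 \<and> [1, 4, 3, 2 :: nat] ! i \<le> [1, 4, 3, 2] ! j" for i j
    unfolding eo_path_def P_def by (simp add: path_edge_eq_iff)
  show ?thesis
    unfolding P_def[symmetric] eo_contains_iff_embedding[OF G P]
  proof
    assume "\<exists>g. inj_on g (verts P) \<and> g ` verts P \<subseteq> verts G \<and> (\<forall>e\<in>edges P. g ` e \<in> edges G) \<and>
      (\<forall>e\<in>edges P. \<forall>e'\<in>edges P. (e, e') \<in> eord P \<longleftrightarrow> (g ` e, g ` e') \<in> eord G)"
    then obtain g where g: "inj_on g (verts P)" "\<forall>e\<in>edges P. g ` e \<in> edges G"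
      "\<forall>e\<in>edges P. \<forall>e'\<in>edges P. (e, e') \<in> eord P \<longleftrightarrow> (g ` e, g ` e') \<in> eord G"
      by blast
    have "distinct [g 0, g (Suc 0), g ?n2, g ?n3, g ?n4]"
      using g(1) by (simp add: verts inj_on_def)
    moreover have E: "{g 0, g (Suc 0)} \<in> edges G" "{g (Suc 0), g ?n2} \<in> edges G"
      "{g ?n2, g ?n3} \<in> edges G"
      "{g ?n3, g ?n4} \<in> edges G"
      using g(2) by (simp_all add: edges)
    \<comment> \<open>\<open>eord\<close> is reflexive, so a strict comparison is the failure of the
      reversed pair.\<close>
    moreover have "({g ?n3, g ?n4}, {g 0, g (Suc 0)}) \<notin> eord G"
      "({g ?n2, g ?n3}, {g ?n3, g ?n4}) \<notin> eord G"
      "({g (Suc 0), g ?n2}, {g ?n2, g ?n3}) \<notin> eord G"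
      using g(3) by (simp_all add: edges ord)
    then have "t {g 0, g (Suc 0)} < t {g ?n3, g ?n4}" "t {g ?n3, g ?n4} < t {g ?n2, g ?n3}"
      "t {g ?n2, g ?n3} < t {g (Suc 0), g ?n2}"
      using E by (simp_all add: t)
    ultimately show ?R by blast
  next
    assume ?R
    then obtain v w z y x where dist: "distinct [v, w, z, y, x]"
      and E: "{v, w} \<in> edges G" "{w, z} \<in> edges G" "{z, y} \<in> edges G" "{y, x} \<in> edges G"
      and less: "t {v, w} < t {y, x}" "t {y, x} < t {z, y}" "t {z, y} < t {w, z}"
      by blast
    let ?g = "(!) [v, w, z, y, x]"
    have "inj_on ?g (verts P)" using dist by (simp add: verts)
    moreover have "?g ` verts P \<subseteq> verts G"
      using E G by (auto simp: verts edge_ordered_graph_def)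
    moreover have "\<forall>e\<in>edges P. ?g ` e \<in> edges G"
      using E by (simp add: edges)
    moreover have "\<forall>e\<in>edges P. \<forall>e'\<in>edges P. (e, e') \<in> eord P \<longleftrightarrow> (?g ` e, ?g ` e') \<in> eord G"
      using E less by (simp add: edges ord t)
    ultimately show "\<exists>g. inj_on g (verts P) \<and> g ` verts P \<subseteq> verts G \<and>
      (\<forall>e\<in>edges P. g ` e \<in> edges G) \<and>
      (\<forall>e\<in>edges P. \<forall>e'\<in>edges P. (e, e') \<in> eord P \<longleftrightarrow> (g ` e, g ` e') \<in> eord G)"
      by blast
  qed
qed

section \<open>Upper bound\<close>

text \<open>This turns the edge order into times that are natural numbers. Down-sets are nested, and
  if x is not below y, then x lies in its own down-set but not in that of y.\<close>

lemma linear_order_on_rank: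
  assumes "finite A" and lin: "linear_order_on A r" and "x \<in> A" "y \<in> A"
  shows "(x, y) \<in> r \<longleftrightarrow> card {z. (z, x) \<in> r} \<le> card {z. (z, y) \<in> r}"
proof -
  have r: "r \<subseteq> A \<times> A" "refl_on A r" "trans r" "antisym r" "total_on A r"
    using lin by (auto simp: order_on_defs)
  have fin: "finite {z. (z, u) \<in> r}" for u
    using r(1) by (intro finite_subset[OF _ \<open>finite A\<close>]) auto
  have mono: "card {z. (z, u) \<in> r} \<le> card {z. (z, v) \<in> r}" if "(u, v) \<in> r" for u v
    using that r(3) by (intro card_mono fin) (auto dest: transD)
  have "card {z. (z, y) \<in> r} < card {z. (z, x) \<in> r}" if "(x, y) \<notin> r"
  proof (intro psubset_card_mono fin)
    have "(x, x) \<in> r" using r(2) assms by (auto simp: refl_on_def)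
    then have "(y, x) \<in> r" using that r(5) assms by (auto simp: total_on_def)
    then have "{z. (z, y) \<in> r} \<subseteq> {z. (z, x) \<in> r}" using r(3) by (auto dest: transD)
    then show "{z. (z, y) \<in> r} \<subset> {z. (z, x) \<in> r}" using \<open>(x, x) \<in> r\<close> that by auto
  qed
  with mono show ?thesis by force
qed

text \<open>Move a remaining element of least key into L, one at a time. Ties may be cut anywhere,
  so the size of L can be prescribed exactly.\<close>

lemma split_by_key:
  fixes s :: "'a \<Rightarrow> 'b::linorder"
  assumes "finite V" and "m \<le> card V"
  shows "\<exists>L\<subseteq>V. card L = m \<and> (\<forall>l\<in>L. \<forall>h\<in>V - L. s l \<le> s h)"
  using assms(2)
proof (induction m)
  case 0
  then show ?case by (intro exI[of _ "{}"]) auto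
next
  case (Suc m)
  then obtain L where L: "L \<subseteq> V" "card L = m" "\<forall>l\<in>L. \<forall>h\<in>V - L. s l \<le> s h" by auto
  have "V - L \<noteq> {}" using L Suc.prems by auto
  then obtain x where x: "x \<in> V - L" "\<forall>h\<in>V - L. s x \<le> s h"
    using \<open>finite V\<close> ex_min_if_finite[of "s ` (V - L)"] by force
  have "finite L" using L(1) \<open>finite V\<close> by (rule finite_subset)
  then show ?case using L x by (intro exI[of _ "insert x L"]) auto
qed

text \<open>If {y, z} is neither the first edge at y nor the last at z, then an earlier edge at y
  and a later edge at z extend it to a forbidden path. So the first edges at L and the last edges at
  H cover C.\<close>

lemma card_cross_edges:
  fixes t :: "'a set \<Rightarrow> nat"
  assumes "finite L" "finite H" "L \<inter> H = {}" and "inj_on t C"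
    and C: "\<And>e. e \<in> C \<Longrightarrow> \<exists>y\<in>L. \<exists>z\<in>H. e = {y, z}"
    and nopath: "\<And>x y z w. x \<in> H \<Longrightarrow> y \<in> L \<Longrightarrow> z \<in> H \<Longrightarrow> w \<in> L \<Longrightarrow>
      {x, y} \<in> C \<Longrightarrow> {y, z} \<in> C \<Longrightarrow> {z, w} \<in> C \<Longrightarrow>
      t {x, y} < t {y, z} \<Longrightarrow> t {y, z} < t {z, w} \<Longrightarrow> False"
  shows "card C \<le> card L + card H"
proof -
  \<comment> \<open>Injectivity of \<open>t\<close> makes these edges unique. At a vertex without
    edges of C the value is arbitrary, which is harmless because only a covering of C is
    needed.\<close>
  define f where "f y = (THE e. e \<in> C \<and> y \<in> e \<and> (\<forall>e'\<in>C. y \<in> e' \<longrightarrow> t e \<le> t e'))" for y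
  define g where "g z = (THE e. e \<in> C \<and> z \<in> e \<and> (\<forall>e'\<in>C. z \<in> e' \<longrightarrow> t e' \<le> t e))" for z
  have "C \<subseteq> f ` L \<union> g ` H"
  proof
    fix e assume e: "e \<in> C"
    with C obtain y z where yz: "y \<in> L" "z \<in> H" "e = {y, z}" by blast
    show "e \<in> f ` L \<union> g ` H"
    proof (cases "(\<forall>e'\<in>C. y \<in> e' \<longrightarrow> t e \<le> t e') \<or> (\<forall>e'\<in>C. z \<in> e' \<longrightarrow> t e' \<le> t e)")
      case True
      then show ?thesis
      proof
        assume *: "\<forall>e'\<in>C. y \<in> e' \<longrightarrow> t e \<le> t e'"
        have "f y = e" unfolding f_def
        proof (rule the_equality)
          fix e' assume e': "e' \<in> C \<and> y \<in> e' \<and> (\<forall>e\<in>C. y \<in> e \<longrightarrow> t e' \<le> t e)"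
          then have "t e' = t e" using e yz * by (intro antisym) auto
          then show "e' = e" using inj_onD[OF \<open>inj_on t C\<close>] e e' by blast
        qed (use e yz * in auto)
        then show ?thesis using yz by auto
      next
        assume *: "\<forall>e'\<in>C. z \<in> e' \<longrightarrow> t e' \<le> t e"
        have "g z = e" unfolding g_def
        proof (rule the_equality)
          fix e' assume e': "e' \<in> C \<and> z \<in> e' \<and> (\<forall>e\<in>C. z \<in> e \<longrightarrow> t e \<le> t e')"
          then have "t e' = t e" using e yz * by (intro antisym) auto
          then show "e' = e" using inj_onD[OF \<open>inj_on t C\<close>] e e' by blast
        qed (use e yz * in auto)
        then show ?thesis using yz by auto
      qed
    next
      case False
      then obtain a c where a: "a \<in> C" "y \<in> a" "t a < t e" and c: "c \<in> C" "z \<in> c" "t e < t c"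
        by (auto simp: not_le)
      obtain x where x: "x \<in> H" "a = {x, y}"
        using C[OF a(1)] a(2) yz(1) \<open>L \<inter> H = {}\<close> by (auto simp: insert_commute)
      obtain w where w: "w \<in> L" "c = {z, w}"
        using C[OF c(1)] c(2) yz(2) \<open>L \<inter> H = {}\<close> by (auto simp: insert_commute)
      show ?thesis
        using nopath[of x y z w] x w yz a c e by auto
    qed
  qed
  then have "card C \<le> card (f ` L \<union> g ` H)"
    using assms by (intro card_mono) auto
  also have "\<dots> \<le> card (f ` L) + card (g ` H)" by (rule card_Un_le)
  also have "\<dots> \<le> card L + card H" using assms by (intro add_mono card_image_le)
  finally show ?thesis .
qed

text \<open>Halve V by \<open>s\<close> and induct with \<open>s\<close> and \<open>t\<close> fixed;
  both hypotheses on E pass to subsets of E. The cross edges number at most card V, and 2 * (k *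
  2^k) + 2^(k+1) = (k+1) * 2^(k+1).\<close>

lemma card_edges_no_late_increasing_path:
  fixes t :: "'a set \<Rightarrow> nat" and s :: "'a \<Rightarrow> nat"
  assumes "finite V" and "card V \<le> 2 ^ k"
    and E: "\<And>e. e \<in> E \<Longrightarrow> e \<subseteq> V \<and> card e = 2" and inj: "inj_on t E"
    and s: "\<And>e v. e \<in> E \<Longrightarrow> v \<in> e \<Longrightarrow> s v \<le> t e"
    and nopath: "\<And>x y z w. distinct [x, y, z, w] \<Longrightarrow>
      {x, y} \<in> E \<Longrightarrow> {y, z} \<in> E \<Longrightarrow> {z, w} \<in> E \<Longrightarrow>
      t {x, y} < t {y, z} \<Longrightarrow> t {y, z} < t {z, w} \<Longrightarrow> s w \<le> t {x, y} \<Longrightarrow> False"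
  shows "card E \<le> k * 2 ^ k"
  using assms
proof (induction k arbitrary: V E)
  case 0
  have "E = {}"
  proof (rule ccontr)
    assume "E \<noteq> {}"
    then obtain e where "e \<subseteq> V" "card e = 2" using 0(3) by blast
    then show False using 0(1,2) card_mono[of V e] by simp
  qed
  then show ?case by simp
next
  case (Suc k)
  note E = Suc.prems(3) and inj = Suc.prems(4) and s = Suc.prems(5) and nopath = Suc.prems(6)
  obtain L where L: "L \<subseteq> V" "card L = card V div 2" "\<forall>l\<in>L. \<forall>h\<in>V - L. s l \<le> s h"
    using split_by_key[of V "card V div 2" s] Suc.prems(1) by auto
  define H where "H = V - L"
  have fin: "finite L" "finite H" using L Suc.prems(1) by (auto simp: H_def intro: finite_subset)
  have cH: "card H = card V - card V div 2" using L fin by (simp add: H_def card_Diff_subset)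
  define EL where "EL = {e \<in> E. e \<subseteq> L}"
  define EH where "EH = {e \<in> E. e \<subseteq> H}"
  define C where "C = {e \<in> E. \<exists>y\<in>L. \<exists>z\<in>H. e = {y, z}}"
  have split: "E \<subseteq> EL \<union> EH \<union> C"
  proof
    fix e assume e: "e \<in> E"
    with E obtain a b where ab: "e = {a, b}" "a \<in> V" "b \<in> V"
      by (metis card_2_iff insert_subset)
    then show "e \<in> EL \<union> EH \<union> C"
      using e L(1) unfolding EL_def EH_def C_def H_def by (auto simp: insert_commute)
  qed
  have finE: "finite E"
    using E by (intro finite_subset[of E "Pow V"]) (auto simp: Suc.prems(1))
  have "card EL \<le> k * 2 ^ k"
  proof (rule Suc.IH[of L EL])
    show "card L \<le> 2 ^ k" using L(2) Suc.prems(2) by simp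
    show "inj_on t EL" using inj by (rule inj_on_subset) (auto simp: EL_def)
    show "s v \<le> t e" if "e \<in> EL" "v \<in> e" for e v using that s by (auto simp: EL_def)
    have sub: "e \<in> E" if "e \<in> EL" for e using that by (simp add: EL_def)
    show False if "distinct [x, y, z, w]" "{x, y} \<in> EL" "{y, z} \<in> EL" "{z, w} \<in> EL"
      "t {x, y} < t {y, z}" "t {y, z} < t {z, w}" "s w \<le> t {x, y}" for x y z w
      by (rule nopath[OF that(1) that(2-4)[THEN sub] that(5-7)])
  qed (use fin E in \<open>auto simp: EL_def\<close>)
  moreover have "card EH \<le> k * 2 ^ k"
  proof (rule Suc.IH[of H EH])
    \<comment> \<open>H is the half that is rounded up; it still fits because the bound 2^(k+1) on
      card V is even.\<close>
    show "card H \<le> 2 ^ k" using cH Suc.prems(2) by simp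
    show "inj_on t EH" using inj by (rule inj_on_subset) (auto simp: EH_def)
    show "s v \<le> t e" if "e \<in> EH" "v \<in> e" for e v using that s by (auto simp: EH_def)
    have sub: "e \<in> E" if "e \<in> EH" for e using that by (simp add: EH_def)
    show False if "distinct [x, y, z, w]" "{x, y} \<in> EH" "{y, z} \<in> EH" "{z, w} \<in> EH"
      "t {x, y} < t {y, z}" "t {y, z} < t {z, w}" "s w \<le> t {x, y}" for x y z w
      by (rule nopath[OF that(1) that(2-4)[THEN sub] that(5-7)])
  qed (use fin E in \<open>auto simp: EH_def\<close>)
  moreover have "card C \<le> card L + card H"
  proof (rule card_cross_edges[OF fin])
    show "inj_on t C" using inj by (rule inj_on_subset) (auto simp: C_def)
  next
    fix x y z w
    assume m: "x \<in> H" "y \<in> L" "z \<in> H" "w \<in> L" and c: "{x, y} \<in> C" "{y, z} \<in> C" "{z, w} \<in> C"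
      and l: "t {x, y} < t {y, z}" "t {y, z} < t {z, w}"
    have e: "{x, y} \<in> E" "{y, z} \<in> E" "{z, w} \<in> E" using c by (auto simp: C_def)
    \<comment> \<open>If x = z or y = w, two consecutive edges would coincide, against the strict
      times. All other pairs lie on opposite sides of the split.\<close>
    have "x \<noteq> z" using l by (auto simp: insert_commute)
    moreover have "y \<noteq> w" using l by (auto simp: insert_commute)
    ultimately have "distinct [x, y, z, w]" using m by (auto simp: H_def)
    \<comment> \<open>The split gives s w \<le> s x, and no edge at x is earlier than s x.\<close>
    moreover have "s w \<le> t {x, y}"
      using L(3) m s[OF e(1), of x] unfolding H_def by force
    ultimately show False by (rule nopath[OF _ e l])
  qed (auto simp: C_def H_def)
  moreover have "card L + card H = card V" using L cH by simp
  moreover have "card E \<le> card EL + card EH + card C"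
  proof -
    have "card E \<le> card (EL \<union> EH \<union> C)"
      using finE split by (intro card_mono) (auto simp: EL_def EH_def C_def)
    also have "\<dots> \<le> card (EL \<union> EH) + card C" by (rule card_Un_le)
    also have "\<dots> \<le> card EL + card EH + card C" by (intro add_right_mono card_Un_le)
    finally show ?thesis .
  qed
  ultimately show ?case using Suc.prems(2) by simp
qed

text \<open>Distinct elements have distinct ranks, so those of rank below m inject into
  \<open>{..<m}\<close>. This bounds the number of edges deleted at one vertex.\<close>

lemma card_low_rank_le:
  fixes t :: "'a \<Rightarrow> nat"
  assumes "finite A" and "inj_on t A"
  shows "card {a \<in> A. card {b \<in> A. t b < t a} < m} \<le> m"
proof -
  let ?r = "\<lambda>a. card {b \<in> A. t b < t a}"
  have mono: "?r a < ?r b" if "a \<in> A" "t a < t b" for a b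
    using that \<open>finite A\<close> by (intro psubset_card_mono) auto
  have "inj_on ?r {a \<in> A. ?r a < m}"
  proof (rule inj_onI)
    fix a b assume ab: "a \<in> {a \<in> A. ?r a < m}" "b \<in> {a \<in> A. ?r a < m}" "?r a = ?r b"
    then have "t a = t b" using mono[of a b] mono[of b a]
      by (cases "t a" "t b" rule: linorder_cases) auto
    then show "a = b" using ab inj_onD[OF \<open>inj_on t A\<close>] by auto
  qed
  then have "card {a \<in> A. ?r a < m} \<le> card {..<m}"
    by (rule card_inj_on_le) auto
  then show ?thesis by simp
qed

text \<open>The deleted edges account for the linear term. The remaining ones satisfy the hypotheses
  of \<open>card_edges_no_late_increasing_path\<close>, since a late increasing path ending in w
  would be completed to the pattern by an old edge at w.\<close>

lemma card_edges_P5_1432_free: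
  assumes G: "edge_ordered_graph G" and free: "\<not> eo_contains G (eo_path [1, 4, 3, 2])"
    and k: "card (verts G) \<le> 2 ^ k"
  shows "card (edges G) \<le> 3 * card (verts G) + k * 2 ^ k"
proof -
  define V where "V = verts G"
  define E where "E = edges G"
  define t where "t e = card {e'. (e', e) \<in> eord G}" for e
  have V: "finite V" and E2: "\<And>e. e \<in> E \<Longrightarrow> e \<subseteq> V \<and> card e = 2"
    and lin: "linear_order_on E (eord G)"
    using G by (auto simp: edge_ordered_graph_def V_def E_def)
  have finE: "finite E" using E2 V by (intro finite_subset[of E "Pow V"]) auto
  have t: "(e, e') \<in> eord G \<longleftrightarrow> t e \<le> t e'" if "e \<in> E" "e' \<in> E" for e e'
    unfolding t_def using linear_order_on_rank[OF finE lin that] .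
  have inj: "inj_on t E"
  proof (rule inj_onI)
    fix e e' assume "e \<in> E" "e' \<in> E" "t e = t e'"
    then have "(e, e') \<in> eord G" "(e', e) \<in> eord G" by (simp_all add: t)
    then show "e = e'" using lin by (auto simp: order_on_defs antisym_def)
  qed
  define D where "D v = {e \<in> {e \<in> E. v \<in> e}. card {b \<in> {e \<in> E. v \<in> e}. t b < t e} < 3}" for v
  define F where "F = E - (\<Union>v\<in>V. D v)"
  \<comment> \<open>The minimum exists only if v has three edges. Every end of an edge e of F
    qualifies, with witness \<open>t e\<close>. Older edges are counted in E, so deleted edges may
    complete the pattern.\<close>
  define s where "s v = (LEAST r. 3 \<le> card {b \<in> E. v \<in> b \<and> t b < r})" for v
  have F: "e \<in> E" "3 \<le> card {b \<in> E. v \<in> b \<and> t b < t e}" if "e \<in> F" "v \<in> e" for e v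
  proof -
    show "e \<in> E" using that by (simp add: F_def)
    then have "v \<in> V" using that E2 by blast
    then have "e \<notin> D v" using that by (auto simp: F_def)
    then show "3 \<le> card {b \<in> E. v \<in> b \<and> t b < t e}"
      using that \<open>e \<in> E\<close> by (simp add: D_def conj_assoc not_less)
  qed
  have "card F \<le> k * 2 ^ k"
  proof (rule card_edges_no_late_increasing_path[OF V])
    show "card V \<le> 2 ^ k" using k by (simp add: V_def)
    show "e \<subseteq> V \<and> card e = 2" if "e \<in> F" for e using that E2 by (auto simp: F_def)
    show "inj_on t F" using inj by (rule inj_on_subset) (auto simp: F_def)
    show "s v \<le> t e" if "e \<in> F" "v \<in> e" for e v
      unfolding s_def using F(2)[OF that] by (rule Least_le)
  next
    fix x y z w
    assume dist: "distinct [x, y, z, w]" and e: "{x, y} \<in> F" "{y, z} \<in> F" "{z, w} \<in> F"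
      and l: "t {x, y} < t {y, z}" "t {y, z} < t {z, w}" and sw: "s w \<le> t {x, y}"
    let ?B = "{b \<in> E. w \<in> b \<and> t b < s w}"
    have "3 \<le> card ?B"
      unfolding s_def by (rule LeastI[of _ "t {z, w}"]) (use F(2)[OF e(3), of w] in simp)
    moreover have "card {{w, x}, {w, y}} \<le> 2" by (simp add: card_insert_if)
    \<comment> \<open>This is why three edges are deleted per vertex: two of the older edges at w
      might lead to x and y.\<close>
    ultimately have "\<not> ?B \<subseteq> {{w, x}, {w, y}}"
      using card_mono[of "{{w, x}, {w, y}}" ?B] by auto
    then obtain d where d: "d \<in> E" "w \<in> d" "t d < s w" "d \<noteq> {w, x}" "d \<noteq> {w, y}" by blast
    then obtain v where v: "d = {v, w}" "v \<noteq> w"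
      using E2[OF d(1)] by (auto simp: card_2_iff insert_commute)
    have "v \<noteq> x" "v \<noteq> y" using d v by (auto simp: insert_commute)
    \<comment> \<open>d is older than {x, y}, hence older than {z, w}.\<close>
    moreover have "v \<noteq> z" using d v l sw by auto
    ultimately have "distinct [v, w, z, y, x]" using dist v by auto
    moreover have "{v, w} \<in> E" "{w, z} \<in> E" "{z, y} \<in> E" "{y, x} \<in> E"
      using d v e F(1) by (auto simp: insert_commute)
    moreover have "t {v, w} < t {y, x}" "t {y, x} < t {z, y}" "t {z, y} < t {w, z}"
      using l d v sw by (auto simp: insert_commute)
    ultimately show False
      using free eo_contains_P5_1432[OF G t] unfolding E_def by blast
  qed
  moreover have "card (\<Union>v\<in>V. D v) \<le> card V * 3"
  proof -
    have "card (\<Union>v\<in>V. D v) \<le> (\<Sum>v\<in>V. card (D v))" by (rule card_UN_le[OF V])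
    also have "\<dots> \<le> (\<Sum>v\<in>V. 3)"
      unfolding D_def using finE inj
      by (intro sum_mono card_low_rank_le) (auto intro: inj_on_subset)
    finally show ?thesis by simp
  qed
  moreover have "card E \<le> card F + card (\<Union>v\<in>V. D v)"
  proof -
    have "E = F \<union> (\<Union>v\<in>V. D v)" by (auto simp: F_def D_def)
    then show ?thesis using card_Un_le[of F "\<Union>v\<in>V. D v"] by simp
  qed
  ultimately show ?thesis by (simp add: V_def E_def)
qed

section \<open>Lower bound\<close>

definition pow2_edges :: "nat \<Rightarrow> nat set set" where
  "pow2_edges n = {{v, v + 2 ^ k} | v k. v + 2 ^ k < n}"

text \<open>Lexicographic comparison by \<open>Max\<close>, then \<open>Min\<close>, encoded as a
  two-digit number in base n.\<close>

definition lex_code :: "nat \<Rightarrow> nat set \<Rightarrow> nat" where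
  "lex_code n e = Max e * n + Min e"

definition pow2_graph :: "nat \<Rightarrow> nat eograph" where
  "pow2_graph n = \<lparr> verts = {..<n}, edges = pow2_edges n,
     eord = {(e, e'). e \<in> pow2_edges n \<and> e' \<in> pow2_edges n \<and> lex_code n e \<le> lex_code n e'} \<rparr>"

text \<open>The last digit \<open>Min e'\<close> is below n, so it cannot make up for a smaller
  leading digit.\<close>

lemma lex_code_less:
  assumes "e \<subseteq> {..<n}" "e' \<subseteq> {..<n}" "e \<noteq> {}" "e' \<noteq> {}" and "lex_code n e \<le> lex_code n e'"
  shows "Max e < Max e' \<or> Max e = Max e' \<and> Min e \<le> Min e'"
proof -
  have fin: "finite e" "finite e'" using assms finite_subset by blast+
  have "Min e' \<in> e'" using fin assms by simp
  then have "Min e' < n" using assms by auto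
  have "\<not> Max e' < Max e"
  proof
    assume "Max e' < Max e"
    then have "Suc (Max e') * n \<le> Max e * n" by (intro mult_le_mono1) simp
    then show False using assms(5) \<open>Min e' < n\<close> by (simp add: lex_code_def)
  qed
  then show ?thesis using assms(5) by (auto simp: lex_code_def)
qed

lemma pow2_edgesD:
  assumes "{a, b} \<in> pow2_edges n"
  shows "a < n" "b < n" "a \<noteq> b" "a < b \<Longrightarrow> \<exists>k. b = a + 2 ^ k"
  using assms by (auto simp: pow2_edges_def doubleton_eq_iff)

lemma edge_ordered_pow2_graph: "edge_ordered_graph (pow2_graph n)"
proof -
  have E: "e \<subseteq> {..<n}" "card e = 2" if "e \<in> pow2_edges n" for e
    using that by (auto simp: pow2_edges_def)
  have "antisym (eord (pow2_graph n))"
  proof (rule antisymI)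
    fix e e' assume "(e, e') \<in> eord (pow2_graph n)" "(e', e) \<in> eord (pow2_graph n)"
    then have m: "e \<in> pow2_edges n" "e' \<in> pow2_edges n"
      and c: "lex_code n e \<le> lex_code n e'" "lex_code n e' \<le> lex_code n e"
      by (auto simp: pow2_graph_def)
    \<comment> \<open>Maximum and minimum together determine an edge.\<close>
    have "Max e = Max e' \<and> Min e = Min e'"
      using lex_code_less[of e n e'] lex_code_less[of e' n e] c E m by fastforce
    then show "e = e'" using m
      by (auto simp: pow2_edges_def)
  qed
  then have "linear_order_on (pow2_edges n) (eord (pow2_graph n))"
    by (auto simp: order_on_defs refl_on_def total_on_def trans_def pow2_graph_def)
  then show ?thesis using E by (auto simp: edge_ordered_graph_def pow2_graph_def)
qed

lemma pow2_graph_P5_1432_free: "\<not> eo_contains (pow2_graph n) (eo_path [1, 4, 3, 2])"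
proof
  let ?E = "pow2_edges n" and ?t = "lex_code n"
  assume "eo_contains (pow2_graph n) (eo_path [1, 4, 3, 2])"
  then obtain v w z y x where dist: "distinct [v, w, z, y, x]"
    and E: "{v, w} \<in> ?E" "{w, z} \<in> ?E" "{z, y} \<in> ?E" "{y, x} \<in> ?E"
    and l: "?t {v, w} < ?t {y, x}" "?t {y, x} < ?t {z, y}" "?t {z, y} < ?t {w, z}"
    using eo_contains_P5_1432[OF edge_ordered_pow2_graph[of n], of ?t]
    by (auto simp: pow2_graph_def)
  have lex: "max a b < max c d \<or> max a b = max c d \<and> min a b \<le> min c d"
    if "{a, b} \<in> ?E" "{c, d} \<in> ?E" "?t {a, b} < ?t {c, d}" for a b c d
    using lex_code_less[of "{a, b}" n "{c, d}"] pow2_edgesD(1,2)[OF that(1)]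
      pow2_edgesD(1,2)[OF that(2)] that(3) by auto
  note lexs = lex[OF E(1,4) l(1)] lex[OF E(4,3) l(2)] lex[OF E(3,2) l(3)]
  \<comment> \<open>Two edges with a common vertex are ordered like their other ends, so x < z and y
    < w. As {v, w} precedes {y, x}, w is at most the larger of x and y, which must then be
    x.\<close>
  have ord: "y < w" "w < x" "x < z"
    using lexs dist by (auto simp: max_def min_def split: if_splits)
  obtain i where i: "z = w + 2 ^ i" using pow2_edgesD(4)[OF E(2)] ord by auto
  obtain j where j: "z = y + 2 ^ j"
    using pow2_edgesD(4)[of y z n] E(3) ord by (auto simp: insert_commute)
  obtain l where l: "x = y + 2 ^ l" using pow2_edgesD(4)[OF E(4)] ord by auto
  have "(2::nat) ^ i < 2 ^ j" using i j ord by linarith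
  then have "i < j" by simp
  have "(2::nat) ^ l < 2 ^ j" using l j ord by linarith
  then have "l < j" by simp
  have half: "2 * (2::nat) ^ a \<le> 2 ^ j" if "a < j" for a
    using that power_increasing[of "Suc a" j "2::nat"] by simp
  \<comment> \<open>Adding the two bounds gives (z - w) + (x - y) \<le> z - y, that is, x \<le>
    w.\<close>
  show False using half[OF \<open>i < j\<close>] half[OF \<open>l < j\<close>] i j l ord by linarith
qed

text \<open>For each k < m there are n - 2^k edges of difference 2^k, and 2 * 2^k \<le> 2^m \<le> n
  makes this at least n/2.\<close>

lemma card_pow2_edges_ge:
  assumes "2 ^ m \<le> n"
  shows "real m * (real n / 2) \<le> real (card (pow2_edges n))"
proof -
  let ?S = "SIGMA k:{..<m}. {..<n - 2 ^ k}"
  let ?f = "\<lambda>(k, v). {v, v + 2 ^ k :: nat}"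
  have "inj_on ?f ?S" by (auto simp: inj_on_def doubleton_eq_iff)
  moreover have "?f ` ?S \<subseteq> pow2_edges n" by (force simp: pow2_edges_def)
  moreover have "finite (pow2_edges n)"
    by (rule finite_subset[of _ "Pow {..<n}"]) (auto simp: pow2_edges_def)
  ultimately have "card ?S \<le> card (pow2_edges n)" by (rule card_inj_on_le)
  moreover have "card ?S = (\<Sum>k<m. n - 2 ^ k)" by simp
  moreover have "(\<Sum>k<m. real n / 2) \<le> (\<Sum>k<m. real (n - 2 ^ k))"
  proof (rule sum_mono)
    fix k assume "k \<in> {..<m}"
    then have "(2::nat) ^ Suc k \<le> 2 ^ m" by (intro power_increasing) auto
    then have "2 * 2 ^ k \<le> n" using assms by simp
    then have "n \<le> 2 * (n - 2 ^ k)" by simp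
    then show "real n / 2 \<le> real (n - 2 ^ k)" by linarith
  qed
  ultimately show ?thesis by (simp flip: of_nat_sum)
qed

section \<open>Bounds on the extremal function and their asymptotic form\<close>

lemma ex_eo_P5_1432_le:
  assumes "n \<le> 2 ^ k"
  shows "ex_eo n (eo_path [1, 4, 3, 2]) \<le> 3 * n + k * 2 ^ k"
proof -
  let ?S = "eo_avoiding_sizes n (eo_path [1, 4, 3, 2])"
  have "?S \<noteq> {}" using eo_avoiding_sizes_nonempty[of "eo_path [1, 4, 3, 2]" n]
    by (auto simp: eo_path_def)
  then show ?thesis
    unfolding ex_eo_def using card_edges_P5_1432_free assms
    by (subst Max_le_iff) (auto simp: finite_eo_avoiding_sizes, auto simp: eo_avoiding_sizes_def)
qed

lemma ex_eo_P5_1432_ge: "card (pow2_edges n) \<le> ex_eo n (eo_path [1, 4, 3, 2])"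
  unfolding ex_eo_def
proof (rule Max_ge[OF finite_eo_avoiding_sizes])
  show "card (pow2_edges n) \<in> eo_avoiding_sizes n (eo_path [1, 4, 3, 2])"
    unfolding eo_avoiding_sizes_def
    using edge_ordered_pow2_graph[of n] pow2_graph_P5_1432_free[of n]
    by (intro CollectI exI[of _ "pow2_graph n"]) (auto simp: pow2_graph_def)
qed

theorem theorem4p12:
  shows "(\<lambda>n. real (ex_eo n (eo_path [1, 4, 3, 2]))) \<in> \<Theta>(\<lambda>n. real n * ln (real n))"
proof -
  let ?f = "\<lambda>n. ex_eo n (eo_path [1, 4, 3, 2])"
  have pow: "\<exists>m. 2 ^ m \<le> n \<and> n < 2 ^ Suc m" if "n \<ge> 2" for n :: nat
    using that ex_power_ivl1[of 2 n] by auto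
  have up: "real (?f n) \<le> 7 / ln 2 * (real n * ln (real n))"
    and lo: "1 / 4 * (real n * ln (real n)) \<le> real (?f n)" if n: "n \<ge> 2" for n
  proof -
    obtain m where m: "2 ^ m \<le> n" "n < 2 ^ Suc m" using pow[OF n] by blast
    have "m \<noteq> 0" using m n by (cases m) auto
    have "real (2 ^ m) \<le> real n" using m(1) by (simp only: of_nat_le_iff)
    then have "ln (2 ^ m) \<le> ln (real n)" using n by (subst ln_le_cancel_iff) auto
    then have ln_ge: "real m * ln 2 \<le> ln (real n)" by (simp add: ln_realpow)
    have "real n \<le> real (2 ^ Suc m)" using m(2) by (simp only: of_nat_le_iff less_imp_le)
    then have "ln (real n) \<le> ln (2 ^ Suc m)" using n by (subst ln_le_cancel_iff) auto
    then have ln_le: "ln (real n) \<le> real (Suc m) * ln 2" by (simp only: ln_realpow)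
    \<comment> \<open>Rounding n up to the power 2^(m+1) at most doubles it. As m is at least 1, 3n
      + 2n(m+1) = 5n + 2nm is at most 7nm.\<close>
    have "?f n \<le> 3 * n + Suc m * 2 ^ Suc m" using m(2) by (intro ex_eo_P5_1432_le) simp
    also have "\<dots> \<le> 3 * n + Suc m * (2 * n)"
      using m(1) by (intro add_left_mono mult_left_mono) auto
    also have "\<dots> \<le> 7 * (n * m)" using \<open>m \<noteq> 0\<close> by (cases m) auto
    finally have "real (?f n) \<le> 7 * (real n * real m)"
      by (metis of_nat_le_iff of_nat_mult of_nat_numeral)
    also have "\<dots> \<le> 7 * (real n * (ln (real n) / ln 2))"
      using ln_ge by (intro mult_left_mono) (auto simp: field_simps)
    finally show "real (?f n) \<le> 7 / ln 2 * (real n * ln (real n))" by simp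
    \<comment> \<open>From ln 2 \<le> 1 and m + 1 \<le> 2m follows ln n \<le> 2m; together with the
      nm/2 edges this yields the constant 1/4.\<close>
    have "real (Suc m) * ln 2 \<le> real (Suc m) * 1"
      using ln_le_minus_one[of 2] by (intro mult_left_mono) auto
    also have "\<dots> \<le> 2 * real m" using \<open>m \<noteq> 0\<close> by simp
    finally have "ln (real n) \<le> 2 * real m" using ln_le by simp
    then have "real n * ln (real n) \<le> real n * (2 * real m)" by (intro mult_left_mono) auto
    then have "1 / 4 * (real n * ln (real n)) \<le> real m * (real n / 2)" by (simp add: mult_ac)
    also have "\<dots> \<le> real (?f n)"
      using card_pow2_edges_ge[OF m(1)] ex_eo_P5_1432_ge[of n] by linarith
    finally show "1 / 4 * (real n * ln (real n)) \<le> real (?f n)" .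
  qed
  show ?thesis
  proof (rule bigthetaI)
    show "(\<lambda>n. real (?f n)) \<in> O(\<lambda>n. real n * ln (real n))"
      using up by (intro bigoI[of _ "7 / ln 2"] eventually_sequentiallyI[of 2]) auto
    show "(\<lambda>n. real (?f n)) \<in> \<Omega>(\<lambda>n. real n * ln (real n))"
      using lo by (intro landau_omega.bigI[of "1/4"] eventually_sequentiallyI[of 2]) auto
  qed
qed

end
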